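(* As $n\to\infty$, $$\mathrm{ex}_3(n,\widetilde C_6)=\Theta(n^{7/3}),$$ that is, there exist constants $c_1,c_2>0$ and $n_0$ such that $c_1n^{7/3}\le \mathrm{ex}_3(n,\widetilde C_6)\le c_2n^{7/3}$ for all $n\ge n_0$.
   Context: A 3-graph (3-uniform hypergraph, triple system) on a vertex set $V$ is a set of 3-element subsets of $V$, called (hyper)edges. For 3-graphs $G$ and $H$, $G$ is $H$-free if $G$ contains no (not necessarily induced) subgraph isomorphic to $H$. $\mathrm{ex}_3(n,H)$ is the maximum number of edges in an $H$-free 3-graph on $n$ vertices. $C_6$ is the cycle with $6$ vertices. For a graph $G$, the hypergraph suspension $\widetilde G$ is the 3-graph obtained by adding one new vertex $x$ to $V(G)$ and taking as hyperedges the sets $e\cup\{x\}$ for $e\in E(G)$. (Equivalently, a 3-graph $H$ is $\widetilde C_6$-free iff for every vertex $x$ the link graph with vertex set $V(H)\setminus\{x\}$ and edges $\{uv:\{x,u,v\}\in H\}$ contains no $C_6$.) *)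

theory Defs
  imports "HOL-Analysis.Analysis" "HOL-Library.Landau_Symbols"
begin

text \<open>A (hyper)graph is a pair of a vertex set and a set of edges, each edge being a set of
  vertices.  The vertex set is explicit, so isolated vertices are allowed.\<close>

type_synonym 'a hypergraph = "'a set \<times> 'a set set"

abbreviation verts :: "'a hypergraph \<Rightarrow> 'a set" where
  "verts G \<equiv> fst G"

abbreviation edges :: "'a hypergraph \<Rightarrow> 'a set set" where
  "edges G \<equiv> snd G"

definition uniform :: "nat \<Rightarrow> 'a hypergraph \<Rightarrow> bool" where
  "uniform r G \<longleftrightarrow> (\<forall>e\<in>edges G. e \<subseteq> verts G \<and> card e = r)"

definition subhypergraph :: "'a hypergraph \<Rightarrow> 'a hypergraph \<Rightarrow> bool" where
  "subhypergraph F G \<longleftrightarrow> verts F \<subseteq> verts G \<and> edges F \<subseteq> edges G \<and> (\<forall>e\<in>edges F. e \<subseteq> verts F)"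

definition isomorphic :: "'a hypergraph \<Rightarrow> 'b hypergraph \<Rightarrow> bool" where
  "isomorphic G H \<longleftrightarrow> (\<exists>f. bij_betw f (verts G) (verts H) \<and> edges H = (\<lambda>e. f ` e) ` edges G)"

definition hfree :: "'b hypergraph \<Rightarrow> 'a hypergraph \<Rightarrow> bool" where
  "hfree H G \<longleftrightarrow> \<not> (\<exists>F. subhypergraph F G \<and> isomorphic F H)"

text \<open>The hosts are taken on finite sets of natural numbers, which is no restriction up to
  isomorphism.  The maximum is meaningful whenever \<open>H\<close> has an edge; see \<open>ex3_attained\<close>.\<close>

definition ex3 :: "nat \<Rightarrow> 'b hypergraph \<Rightarrow> nat" where
  "ex3 n H = Max {card (edges G) | G :: nat hypergraph.
     finite (verts G) \<and> card (verts G) = n \<and> uniform 3 G \<and> hfree H G}"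

text \<open>A cycle of the given length, for lengths at least 3.\<close>

definition cycle_graph :: "nat \<Rightarrow> nat hypergraph" where
  "cycle_graph k = ({..<k}, {{i, (i + 1) mod k} | i. i < k})"

text \<open>The new vertex of the suspension is \<open>None\<close>; an old vertex \<open>v\<close> becomes \<open>Some v\<close>.\<close>

definition suspension :: "'a hypergraph \<Rightarrow> 'a option hypergraph" where
  "suspension G = (insert None (Some ` verts G), (\<lambda>e. insert None (Some ` e)) ` edges G)"

lemma ex3_attained:
  fixes H :: "'b hypergraph"
  assumes "edges H \<noteq> {}"
  shows "\<exists>G :: nat hypergraph. finite (verts G) \<and> card (verts G) = n \<and> uniform 3 G \<and> hfree H G
           \<and> card (edges G) = ex3 n H"
    and "\<And>G :: nat hypergraph. \<lbrakk>finite (verts G); card (verts G) = n; uniform 3 G; hfree H G\<rbrakk>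
           \<Longrightarrow> card (edges G) \<le> ex3 n H"
proof -
  define S where "S = {card (edges G) | G :: nat hypergraph.
     finite (verts G) \<and> card (verts G) = n \<and> uniform 3 G \<and> hfree H G}"
  have bound: "card (edges G) \<le> 2 ^ n"
    if "finite (verts G)" "card (verts G) = n" "uniform 3 G" for G :: "nat hypergraph"
  proof -
    have "edges G \<subseteq> Pow (verts G)"
      using that(3) by (auto simp: uniform_def)
    then have "card (edges G) \<le> card (Pow (verts G))"
      using that(1) by (intro card_mono) auto
    then show ?thesis
      using that(1,2) by (simp add: card_Pow)
  qed
  have "S \<subseteq> {..2 ^ n}"
    unfolding S_def using bound by fastforce
  then have fin: "finite S"
    using finite_subset by blast
  have "hfree H (({..<n}, {}) :: nat hypergraph)"
    using assms by (auto simp: hfree_def isomorphic_def subhypergraph_def)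
  then have "card (edges (({..<n}, {}) :: nat hypergraph)) \<in> S"
    unfolding S_def by (intro CollectI exI[of _ "({..<n}, {})"]) (auto simp: uniform_def)
  then have ne: "S \<noteq> {}"
    by blast
  have eq: "ex3 n H = Max S"
    unfolding ex3_def S_def ..
  have "ex3 n H \<in> S"
    unfolding eq using fin ne by (rule Max_in)
  then show "\<exists>G :: nat hypergraph. finite (verts G) \<and> card (verts G) = n \<and> uniform 3 G \<and> hfree H G
           \<and> card (edges G) = ex3 n H"
    unfolding S_def by force
  show "card (edges G) \<le> ex3 n H"
    if "finite (verts G)" "card (verts G) = n" "uniform 3 G" "hfree H G" for G :: "nat hypergraph"
  proof -
    have "card (edges G) \<in> S"
      unfolding S_def using that by blast
    then show ?thesis
      unfolding eq using fin by (rule Max_ge[rotated])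
  qed
qed

end

theory Submission
  imports "HOL-Algebra.Algebraic_Closure_Type" "HOL-Library.Z2" Defs
begin

text \<open>A 3-graph avoids the suspension of \<open>C\<^sub>6\<close> exactly when the link of every vertex, viewed as a
  graph on the remaining vertices, contains no 6-cycle (\<open>hfree_suspension_cycle_iff\<close>).  Both
  bounds are statements about links.

  Upper bound.  A graph without 6-cycles on \<open>n\<close> vertices has \<open>O(n\<^bsup>4/3\<^esup>)\<close> edges, and summing over the
  \<open>n\<close> links gives \<open>O(n\<^bsup>7/3\<^esup>)\<close>.  For the graph bound, pass to a subgraph in which every degree
  exceeds a constant fraction of the average degree, and then to a maximum cut, which at most halves
  the degrees.  In the resulting bipartite graph explore the first three layers around a vertex.  A
  path with four edges between two consecutive layers, with both ends in the inner layer, closes up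
  to a 6-cycle; hence the edges between consecutive layers are at most twice as many as the vertices
  of the two layers (\<open>path_between_parts\<close>), and each layer is larger than the previous one by a factor
  proportional to the minimum degree \<open>\<delta>\<close>.  So \<open>\<delta>\<^sup>3 = O(n)\<close>
  (\<open>bipartite_min_degree_C6_free\<close>).

  Lower bound.  Take three copies of \<open>K\<^sup>3\<close> for a field \<open>K\<close> with \<open>q\<close> elements and join
  \<open>(x,x',x'')\<close>, \<open>(y,y',y'')\<close>, \<open>(z,z',z'')\<close> whenever
  \<open>x' + y' + z' = xy + yz + zx\<close> and \<open>x'' + y'' + z'' = x\<^sup>2y + y\<^sup>2z + z\<^sup>2x\<close>.  There are \<open>3q\<^sup>3\<close> vertices
  and \<open>q\<^sup>7\<close> edges.  With \<open>x\<close> fixed, every monomial on the right other than \<open>yz\<close> and \<open>y\<^sup>2z\<close>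
  depends on only one of \<open>y\<close> and \<open>z\<close>, so it cancels in the alternating sum around a cycle of the
  link: as far as cycles are concerned the link is the graph of Wenger defined by \<open>yz\<close> and \<open>y\<^sup>2z\<close>, in
  which a Vandermonde determinant excludes 6-cycles (\<open>cyclic_rel_no_hexagon\<close>).  Both equations are
  invariant under the cyclic shift of the three parts, so links of vertices of all three parts are of
  this kind.  Letting \<open>q\<close> run through the powers of 2 leaves only gaps of bounded ratio between the
  numbers of vertices, which costs a constant factor for the intermediate \<open>n\<close>.\<close>

section \<open>Graphs without 6-cycles\<close>

lemma card_pairs_Sigma:
  assumes "finite A" "R \<subseteq> A \<times> B" "finite B"
  shows "card R = (\<Sum>a\<in>A. card (R `` {a}))"
proof -
  have "R = (SIGMA a:A. R `` {a})" using assms by auto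
  moreover have "finite (R `` {a})" for a
    using assms by (meson finite_Image finite_SigmaI finite_subset)
  ultimately show ?thesis
    using assms by (metis card_SigmaI)
qed

text \<open>Graphs are represented by symmetric irreflexive relations, so \<open>card R\<close> is twice the number of
  edges.  Removing a vertex of degree at most \<open>d\<close> keeps the number of edges above \<open>d\<close> times the number
  of vertices; this cannot go on until no vertex is left.\<close>
lemma min_degree_subgraph:
  fixes d :: nat
  assumes "finite V" "sym R" "irrefl R" "R \<subseteq> V \<times> V" "2 * d * card V < card R"
  obtains W where "W \<subseteq> V" "W \<noteq> {}" "\<And>v. v \<in> W \<Longrightarrow> d < card (R `` {v} \<inter> W)"
  using assms
proof (induction "card V" arbitrary: V R thesis)
  case 0
  then show ?case by simp
next
  case (Suc n)
  show ?case
  proof (cases "\<forall>v\<in>V. d < card (R `` {v} \<inter> V)")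
    case True
    then show ?thesis using Suc.prems(1)[of V] Suc.hyps(2) by force
  next
    case False
    then obtain v where v: "v \<in> V" "card (R `` {v}) \<le> d"
    proof -
      from False obtain v where "v \<in> V" "card (R `` {v} \<inter> V) \<le> d" by (auto simp: not_less)
      moreover have "R `` {v} \<inter> V = R `` {v}" using Suc.prems(5) by auto
      ultimately show ?thesis using that by simp
    qed
    define R' where "R' = R \<inter> (V - {v}) \<times> (V - {v})"
    have fin: "finite (R `` {v})"
      using Suc.prems(2,5) by (meson finite_Image finite_SigmaI finite_subset)
    have "R \<subseteq> R' \<union> (Pair v ` (R `` {v}) \<union> (\<lambda>w. (w, v)) ` (R `` {v}))"
      using Suc.prems(3,5) by (auto simp: R'_def sym_def)
    then have "card R \<le> card (R' \<union> (Pair v ` (R `` {v}) \<union> (\<lambda>w. (w, v)) ` (R `` {v})))"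
      using fin Suc.prems(2) by (intro card_mono) (auto simp: R'_def)
    also have "\<dots> \<le> card R' + (card (Pair v ` (R `` {v})) + card ((\<lambda>w. (w, v)) ` (R `` {v})))"
      by (meson add_left_mono card_Un_le order_trans)
    also have "\<dots> \<le> card R' + (d + d)"
      using fin v(2) by (intro add_mono order.refl) (meson card_image_le order_trans)+
    finally have "card R \<le> card R' + 2 * d" by simp
    moreover have "n = card (V - {v})"
      using Suc.hyps(2) v(1) by simp
    moreover have "card V = Suc n" using Suc.hyps(2) by simp
    ultimately have less: "2 * d * card (V - {v}) < card R'"
      using Suc.prems(6) by simp
    have R': "sym R'" "irrefl R'" "R' \<subseteq> (V - {v}) \<times> (V - {v})" "finite (V - {v})"
      using Suc.prems(2-4) by (auto simp: R'_def sym_def irrefl_def)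
    obtain W where W: "W \<subseteq> V - {v}" "W \<noteq> {}" "\<And>u. u \<in> W \<Longrightarrow> d < card (R' `` {u} \<inter> W)"
      using Suc.hyps(1)[OF \<open>n = _\<close> _ R'(4,1-3) less] by blast
    have finW: "finite W" using W(1) Suc.prems(2) finite_subset by blast
    have "d < card (R `` {u} \<inter> W)" if "u \<in> W" for u
    proof -
      have "card (R' `` {u} \<inter> W) \<le> card (R `` {u} \<inter> W)"
        using finW by (intro card_mono) (auto simp: R'_def)
      with W(3)[OF that] show ?thesis by simp
    qed
    with W(1,2) show ?thesis by (intro Suc.prems(1)[of W]) auto
  qed
qed

text \<open>Choose \<open>S\<close> to maximise the number of pairs that it separates.  If more than half of the neighbours
  of \<open>v\<close> were on its own side, then moving \<open>v\<close> to the other side would separate more pairs.\<close>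
lemma max_cut:
  assumes "finite W" "sym R" "irrefl R" "R \<subseteq> W \<times> W"
  obtains S where "\<And>v. v \<in> W \<Longrightarrow> card (R `` {v}) \<le> 2 * card {w \<in> R `` {v}. (w \<in> S) \<noteq> (v \<in> S)}"
proof -
  define cut where "cut S = {(u, w) \<in> R. (w \<in> S) \<noteq> (u \<in> S)}" for S
  have finR: "finite R" using assms(1,4) by (meson finite_SigmaI finite_subset)
  have finN: "finite (R `` {v})" for v using finR by (rule finite_Image) 
  have fin: "finite (cut S)" for S by (rule finite_subset[OF _ finR]) (auto simp: cut_def)
  obtain S where S: "\<And>T. card (cut T) \<le> card (cut S)"
  proof -
    have "card (cut T) < Suc (card R)" for T
      by (intro le_imp_less_Suc card_mono finR) (auto simp: cut_def)
    then show ?thesis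
      using that ex_has_greatest_nat[of "\<lambda>_. True" "{}" "\<lambda>S. card (cut S)" "Suc (card R)"]
      by (auto intro: less_imp_le)
  qed
  show thesis
  proof (rule that[of S])
    fix v assume "v \<in> W"
    define T where "T = (if v \<in> S then S - {v} else insert v S)"
    define P where "P = {w \<in> R `` {v}. (w \<in> S) \<noteq> (v \<in> S)}"
    define Q where "Q = {w \<in> R `` {v}. (w \<in> S) = (v \<in> S)}"
    have finPQ: "finite P" "finite Q"
      by (rule finite_subset[OF _ finN[of v]], auto simp: P_def Q_def)+
    have vR: "(v, v) \<notin> R" using assms(3) by (auto simp: irrefl_def)
    define C where "C = {(u, w) \<in> cut S. u \<noteq> v \<and> w \<noteq> v}"
    have eqS: "cut S = C \<union> ({v} \<times> P \<union> P \<times> {v})"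
      using assms(2) vR by (auto simp: cut_def C_def P_def sym_def)
    have eqT: "cut T = C \<union> ({v} \<times> Q \<union> Q \<times> {v})"
      using assms(2) vR by (auto simp: cut_def C_def Q_def T_def sym_def)
    have finC: "finite C" by (rule finite_subset[OF _ fin[of S]]) (auto simp: C_def)
    have "card (cut S) = card C + (card P + card P)" unfolding eqS
      using finC finPQ vR
      by (subst card_Un_disjoint, auto simp: C_def P_def card_cartesian_product)
         (subst card_Un_disjoint, auto simp: card_cartesian_product)
    moreover have "card (cut T) = card C + (card Q + card Q)" unfolding eqT
      using finC finPQ vR
      by (subst card_Un_disjoint, auto simp: C_def Q_def card_cartesian_product)
         (subst card_Un_disjoint, auto simp: card_cartesian_product)
    moreover have "card (R `` {v}) = card P + card Q"
      using finPQ by (subst card_Un_disjoint[symmetric]) (auto simp: P_def Q_def intro!: arg_cong[of _ _ card])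
    ultimately show "card (R `` {v}) \<le> 2 * card {w \<in> R `` {v}. (w \<in> S) \<noteq> (v \<in> S)}"
      using S[of T] by (fold P_def) simp
  qed
qed

lemma two_less_card_ex:
  assumes "2 < card A"
  shows "\<exists>z\<in>A. z \<noteq> x \<and> z \<noteq> y"
proof (rule ccontr)
  assume "\<not> ?thesis"
  then have "A \<subseteq> {x, y}" by blast
  then have "card A \<le> card {x, y}" by (intro card_mono) auto
  also have "\<dots> \<le> 2" by (simp add: card_insert_if)
  finally show False using assms by simp
qed

text \<open>A bipartite graph with more than twice as many edges as vertices has a subgraph of minimum degree
  at least 3, in which a path can be extended greedily: each new vertex has to avoid at most two of
  the earlier ones.\<close>
lemma path_between_parts:
  assumes "finite A" "finite B" "A \<inter> B = {}" "H \<subseteq> A \<times> B" "2 * (card A + card B) < card H"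
  obtains a b c d e where "(a, b) \<in> H" "(c, b) \<in> H" "(c, d) \<in> H" "(e, d) \<in> H"
    "a \<noteq> c" "a \<noteq> e" "c \<noteq> e" "b \<noteq> d"
proof -
  define R where "R = H \<union> H\<inverse>"
  have finH: "finite H" using assms by (meson finite_SigmaI finite_subset)
  have "card R = card H + card (H\<inverse>)"
    unfolding R_def using finH assms(3,4) by (intro card_Un_disjoint) auto
  then have "2 * 2 * card (A \<union> B) < card R"
    using assms by (simp add: card_Un_disjoint)
  moreover have "sym R" "irrefl R" "R \<subseteq> (A \<union> B) \<times> (A \<union> B)"
    using assms(3,4) by (auto simp: R_def sym_def irrefl_def)
  ultimately obtain W where W: "W \<noteq> {}" "\<And>v. v \<in> W \<Longrightarrow> 2 < card (R `` {v} \<inter> W)"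
    using assms(1,2) min_degree_subgraph[of "A \<union> B" R 2] by (metis finite_Un)
  have step: "\<exists>w\<in>W. (v, w) \<in> R \<and> w \<noteq> x \<and> w \<noteq> y" if "v \<in> W" for v x y
    using two_less_card_ex[OF W(2)[OF that], of x y] by blast
  have "\<exists>a\<in>W. a \<in> A"
  proof -
    obtain v where "v \<in> W" using W(1) by blast
    with step[of v v v] show ?thesis using assms(4) by (auto simp: R_def)
  qed
  then obtain a where a: "a \<in> W" "a \<in> A" by blast
  obtain b where b: "b \<in> W" "(a, b) \<in> R" using step[OF a(1)] by blast
  then have ab: "(a, b) \<in> H" "b \<in> B" using a assms(3,4) by (auto simp: R_def)
  obtain c where c: "c \<in> W" "(b, c) \<in> R" "c \<noteq> a" using step[OF b(1)] by blast
  then have cb: "(c, b) \<in> H" "c \<in> A" using ab assms(3,4) by (auto simp: R_def)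
  obtain d where d: "d \<in> W" "(c, d) \<in> R" "d \<noteq> b" using step[OF c(1)] by blast
  then have cd: "(c, d) \<in> H" "d \<in> B" using cb assms(3,4) by (auto simp: R_def)
  obtain e where e: "e \<in> W" "(d, e) \<in> R" "e \<noteq> a" "e \<noteq> c" using step[OF d(1)] by blast
  then have ed: "(e, d) \<in> H" using cd assms(3,4) by (auto simp: R_def)
  show ?thesis using that ab cb cd ed c d e by metis
qed


definition has_cycle :: "nat \<Rightarrow> ('a \<times> 'a) set \<Rightarrow> bool" where
  "has_cycle k R \<longleftrightarrow> (\<exists>c. inj_on c {..<k} \<and> (\<forall>i<k. (c i, c ((i + 1) mod k)) \<in> R))"

lemma has_cycle_6_iff:
  "has_cycle 6 R \<longleftrightarrow> (\<exists>a b c d e f. distinct [a, b, c, d, e, f] \<and>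
     (a, b) \<in> R \<and> (b, c) \<in> R \<and> (c, d) \<in> R \<and> (d, e) \<in> R \<and> (e, f) \<in> R \<and> (f, a) \<in> R)"
proof -
  have six: "{..<6::nat} = {0, 1, 2, 3, 4, 5}" by auto
  have all6: "(\<forall>i<6::nat. P i) \<longleftrightarrow> P 0 \<and> P 1 \<and> P 2 \<and> P 3 \<and> P 4 \<and> P 5" for P
    using six by (metis insert_iff lessThan_iff singletonD)
  show ?thesis
  proof
    assume "has_cycle 6 R"
    then obtain c :: "nat \<Rightarrow> 'a" where inj: "inj_on c {..<6}"
      and edge: "\<forall>i<6. (c i, c ((i + 1) mod 6)) \<in> R"
      unfolding has_cycle_def by blast
    have mods: "(0 + 1) mod 6 = (1::nat)" "(1 + 1) mod 6 = (2::nat)" "(2 + 1) mod 6 = (3::nat)"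
      "(3 + 1) mod 6 = (4::nat)" "(4 + 1) mod 6 = (5::nat)" "(5 + 1) mod 6 = (0::nat)"
      by simp_all
    have "distinct (map c [0, 1, 2, 3, 4, 5])"
      using inj unfolding six by (subst distinct_map) simp
    with edge have "distinct [c 0, c 1, c 2, c 3, c 4, c 5] \<and> (c 0, c 1) \<in> R \<and> (c 1, c 2) \<in> R
      \<and> (c 2, c 3) \<in> R \<and> (c 3, c 4) \<in> R \<and> (c 4, c 5) \<in> R \<and> (c 5, c 0) \<in> R"
      unfolding all6 mods list.map by (intro conjI) (elim conjE, assumption)+
    then show "\<exists>a b c d e f. distinct [a, b, c, d, e, f] \<and>
     (a, b) \<in> R \<and> (b, c) \<in> R \<and> (c, d) \<in> R \<and> (d, e) \<in> R \<and> (e, f) \<in> R \<and> (f, a) \<in> R"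
      by blast
  next
    assume "\<exists>a b c d e f. distinct [a, b, c, d, e, f] \<and>
     (a, b) \<in> R \<and> (b, c) \<in> R \<and> (c, d) \<in> R \<and> (d, e) \<in> R \<and> (e, f) \<in> R \<and> (f, a) \<in> R"
    then obtain a b c d e f where *: "distinct [a, b, c, d, e, f]"
      "(a, b) \<in> R" "(b, c) \<in> R" "(c, d) \<in> R" "(d, e) \<in> R" "(e, f) \<in> R" "(f, a) \<in> R"
      by blast
    have "inj_on ((!) [a, b, c, d, e, f]) {..<6}"
      using *(1) by (intro inj_on_nth) auto
    moreover have "\<forall>i<6. ([a, b, c, d, e, f] ! i, [a, b, c, d, e, f] ! ((i + 1) mod 6)) \<in> R"
      unfolding all6 using * by (simp add: nth_Cons_numeral)
    ultimately show "has_cycle 6 R"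
      unfolding has_cycle_def by blast
  qed
qed

text \<open>Let \<open>L1\<close>, \<open>L2\<close>, \<open>L3\<close> be the vertices at distance 1, 2, 3 from \<open>x\<close>.  A path \<open>a b c d e\<close> with
  \<open>a, c, e \<in> L1\<close> and \<open>b, d \<in> L2\<close> is closed to a 6-cycle by \<open>x\<close>.  In a path \<open>a b c d e\<close> with
  \<open>a, c, e \<in> L2\<close> and \<open>b, d \<in> L3\<close>, if \<open>a\<close> and \<open>c\<close> had distinct neighbours \<open>p\<close> and \<open>q\<close> in \<open>L1\<close>,
  then \<open>x p a b c q\<close> would be a 6-cycle; so \<open>a\<close> and \<open>c\<close>, and likewise \<open>c\<close> and \<open>e\<close>, have the same
  neighbour in \<open>L1\<close>, and this vertex closes the path to a 6-cycle.  Therefore few edges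
  run between consecutive layers, while every vertex of \<open>L1\<close> and \<open>L2\<close> has degree at least \<open>\<delta>\<close>.\<close>
lemma bipartite_min_degree_C6_free:
  fixes \<delta> :: nat
  assumes "finite W" "sym R" "R \<subseteq> W \<times> W" "x \<in> W"
    and bip: "\<And>u v. (u, v) \<in> R \<Longrightarrow> (v \<in> S) \<noteq> (u \<in> S)"
    and deg: "\<And>v. v \<in> W \<Longrightarrow> \<delta> \<le> card (R `` {v})"
    and free: "\<not> has_cycle 6 R" and "6 \<le> \<delta>"
  shows "\<delta> * (\<delta> - 3) * (\<delta> - 6) \<le> 4 * card W"
proof -
  have symD: "(u, v) \<in> R \<Longrightarrow> (v, u) \<in> R" for u v
    using assms(2) by (auto simp: sym_def)
  have finN: "finite (R `` A)" for A
    using assms(1,3) by (meson finite_Image finite_SigmaI finite_subset)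
  define L1 where "L1 = R `` {x}"
  define L2 where "L2 = R `` L1 - {x}"
  define L3 where "L3 = R `` L2 - L1"
  have fin: "finite L1" "finite L2" "finite L3"
    using finN by (auto simp: L1_def L2_def L3_def)
  have sub: "L1 \<subseteq> W" "L2 \<subseteq> W" "L3 \<subseteq> W"
    using assms(3) by (auto simp: L1_def L2_def L3_def)
  have side: "v \<in> L1 \<Longrightarrow> (v \<in> S) \<noteq> (x \<in> S)" "v \<in> L2 \<Longrightarrow> (v \<in> S) = (x \<in> S)"
    "v \<in> L3 \<Longrightarrow> (v \<in> S) \<noteq> (x \<in> S)" for v
    using bip by (auto simp: L1_def L2_def L3_def)
  have disj: "L1 \<inter> L2 = {}" "L2 \<inter> L3 = {}" "L1 \<inter> L3 = {}" "x \<notin> L1" "x \<notin> L2" "x \<notin> L3"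
    using side unfolding L3_def L2_def by blast+
  have no_cycle: False if "distinct [a, b, c, d, e, f]"
    "(a, b) \<in> R" "(b, c) \<in> R" "(c, d) \<in> R" "(d, e) \<in> R" "(e, f) \<in> R" "(f, a) \<in> R" for a b c d e f
    using free that unfolding has_cycle_6_iff by blast

  \<comment> \<open>The edges between consecutive layers, directed away from \<open>x\<close>.\<close>
  define H12 where "H12 = R \<inter> L1 \<times> L2"
  define H23 where "H23 = R \<inter> L2 \<times> L3"

  have up12: "card H12 \<le> 2 * (card L1 + card L2)"
  proof (rule ccontr)
    assume "\<not> ?thesis"
    then obtain a b c d e where p: "(a, b) \<in> H12" "(c, b) \<in> H12" "(c, d) \<in> H12" "(e, d) \<in> H12"
      "a \<noteq> c" "a \<noteq> e" "c \<noteq> e" "b \<noteq> d"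
      using path_between_parts[of L1 L2 H12] fin disj unfolding H12_def by (metis inf_le2 not_le)
    have "(x, a) \<in> R" "(e, x) \<in> R" using p symD by (auto simp: H12_def L1_def)
    with p disj show False
      by (intro no_cycle[of x a b c d e]) (auto simp: H12_def intro: symD)
  qed
  have up23: "card H23 \<le> 2 * (card L2 + card L3)"
  proof (rule ccontr)
    assume "\<not> ?thesis"
    then obtain a b c d e where p: "(a, b) \<in> H23" "(c, b) \<in> H23" "(c, d) \<in> H23" "(e, d) \<in> H23"
      "a \<noteq> c" "a \<noteq> e" "c \<noteq> e" "b \<noteq> d"
      using path_between_parts[of L2 L3 H23] fin disj unfolding H23_def by (metis inf_le2 not_le)
    have same: "p = q" if "(u, b) \<in> H23" "(v, b) \<in> H23" "u \<noteq> v" "p \<in> L1" "q \<in> L1" "(p, u) \<in> R" "(q, v) \<in> R"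
      for u v b p q
    proof (rule ccontr)
      assume "p \<noteq> q"
      moreover have "(x, p) \<in> R" "(q, x) \<in> R" using that symD by (auto simp: L1_def)
      ultimately show False
        using that disj
        by (intro no_cycle[of x p u b v q]) (auto simp: H23_def intro: symD)
    qed
    have parent: "\<exists>p\<in>L1. (p, u) \<in> R" if "(u, b) \<in> H23" for u b
      using that by (auto simp: H23_def L2_def)
    obtain q where q: "q \<in> L1" "(q, a) \<in> R" using parent[OF p(1)] by blast
    obtain q' where q': "q' \<in> L1" "(q', c) \<in> R" using parent[OF p(2)] by blast
    obtain q'' where q'': "q'' \<in> L1" "(q'', e) \<in> R" using parent[OF p(4)] by blast
    have "q = q'" using same[OF p(1,2,5) q(1) q'(1) q(2) q'(2)] .
    moreover have "q' = q''" using same[OF p(3,4,7) q'(1) q''(1) q'(2) q''(2)] .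
    ultimately have "(e, q) \<in> R" using q'' symD by blast
    with p q disj show False
      by (intro no_cycle[of q a b c d e]) (auto simp: H23_def intro: symD)
  qed

  have "(\<delta> - 1) * card L1 \<le> card H12"
  proof -
    have "card H12 = (\<Sum>a\<in>L1. card (H12 `` {a}))"
      using fin by (intro card_pairs_Sigma[where B = L2]) (auto simp: H12_def)
    moreover have "\<delta> - 1 \<le> card (H12 `` {a})" if "a \<in> L1" for a
    proof -
      have "H12 `` {a} = R `` {a} - {x}" using that by (auto simp: H12_def L2_def)
      moreover have "\<delta> \<le> card (R `` {a})" using deg sub(1) that by blast
      moreover have "card (R `` {a}) - card {x} \<le> card (R `` {a} - {x})"
        by (rule diff_card_le_card_Diff) simp
      ultimately show ?thesis by simp
    qed
    ultimately show ?thesis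
      using sum_mono[of L1 "\<lambda>_. \<delta> - 1" "\<lambda>a. card (H12 `` {a})"] by (simp add: mult.commute)
  qed
  with up12 have "(\<delta> - 1) * card L1 \<le> 2 * card L1 + 2 * card L2" by simp
  then have first: "(\<delta> - 3) * card L1 \<le> 2 * card L2"
    using \<open>6 \<le> \<delta>\<close> by (simp add: diff_mult_distrib)
  have "3 * card L1 \<le> (\<delta> - 3) * card L1" using \<open>6 \<le> \<delta>\<close> by (intro mult_right_mono) auto
  from this first have "3 * card L1 \<le> 2 * card L2" by (rule order_trans)
  then have L12: "card L1 \<le> card L2" by simp
  \<comment> \<open>Every edge at a vertex of \<open>L2\<close> leads to \<open>L1\<close> or to \<open>L3\<close>.\<close>
  have "\<delta> * card L2 \<le> card H12 + card H23"
  proof -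
    have "\<delta> * card L2 \<le> (\<Sum>b\<in>L2. card (R `` {b}))"
      using sum_mono[of L2 "\<lambda>_. \<delta>" "\<lambda>a. card (R `` {a})"] deg sub by (simp add: mult.commute subset_iff)
    also have "\<dots> = card (R \<inter> L2 \<times> W)"
      using fin assms(1,3)
      by (subst card_pairs_Sigma[of L2 _ W]) (auto intro!: sum.cong arg_cong[of _ _ card])
    also have "\<dots> \<le> card (H12\<inverse> \<union> H23)"
    proof (rule card_mono)
      show "finite (H12\<inverse> \<union> H23)" using fin by (simp add: H12_def H23_def)
      show "R \<inter> L2 \<times> W \<subseteq> H12\<inverse> \<union> H23" using symD by (auto simp: H12_def H23_def L3_def)
    qed
    also have "\<dots> \<le> card (H12\<inverse>) + card H23" by (rule card_Un_le)
    finally show ?thesis by simp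
  qed
  with up12 up23 L12 have "\<delta> * card L2 \<le> 6 * card L2 + 2 * card L3" by simp
  then have second: "(\<delta> - 6) * card L2 \<le> 2 * card L3"
    using \<open>6 \<le> \<delta>\<close> by (simp add: diff_mult_distrib)
  have "\<delta> * (\<delta> - 3) * (\<delta> - 6) \<le> card L1 * (\<delta> - 3) * (\<delta> - 6)"
    using deg[OF assms(4)] by (intro mult_right_mono) (auto simp: L1_def)
  also have "\<dots> \<le> 2 * card L2 * (\<delta> - 6)"
    using first by (intro mult_right_mono) (auto simp: mult.commute)
  also have "\<dots> \<le> 2 * (2 * card L3)"
    using second by (simp add: mult_ac)
  also have "\<dots> \<le> 4 * card W"
    using card_mono[OF assms(1) sub(3)] by simp
  finally show ?thesis .
qed

text \<open>This is the bound \<open>O(n\<^bsup>4/3\<^esup>)\<close> for graphs without 6-cycles: the average degree cannot exceed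
  \<open>4m\<close> unless \<open>m\<^sup>3 = O(n)\<close>.\<close>
lemma C6_free_power_bound:
  fixes m :: nat
  assumes "finite V" "sym R" "irrefl R" "R \<subseteq> V \<times> V" "\<not> has_cycle 6 R" "10 \<le> m"
    and "4 * m * card V < card R"
  shows "m ^ 3 \<le> 16 * card V"
proof -
  have "2 * (2 * m) * card V < card R" using assms by simp
  then obtain W where W: "W \<subseteq> V" "W \<noteq> {}" "\<And>v. v \<in> W \<Longrightarrow> 2 * m < card (R `` {v} \<inter> W)"
    using min_degree_subgraph[OF assms(1-4), of "2 * m"] by blast
  define Q where "Q = R \<inter> W \<times> W"
  have finW: "finite W" using W(1) assms(1) finite_subset by blast
  have Q: "sym Q" "irrefl Q" "Q \<subseteq> W \<times> W"
    using assms(2,3) by (auto simp: Q_def sym_def irrefl_def)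
  obtain S where S: "\<And>v. v \<in> W \<Longrightarrow> card (Q `` {v}) \<le> 2 * card {w \<in> Q `` {v}. (w \<in> S) \<noteq> (v \<in> S)}"
    using max_cut[OF finW Q] by blast
  define T where "T = {(u, w) \<in> Q. (w \<in> S) \<noteq> (u \<in> S)}"
  obtain x where x: "x \<in> W" using W(2) by blast
  have deg: "m \<le> card (T `` {v})" if "v \<in> W" for v
  proof -
    have "R `` {v} \<inter> W = Q `` {v}" using that by (auto simp: Q_def)
    then have "2 * m < card (Q `` {v})" using W(3)[OF that] by simp
    moreover have "T `` {v} = {w \<in> Q `` {v}. (w \<in> S) \<noteq> (v \<in> S)}" by (auto simp: T_def)
    ultimately show ?thesis using S[OF that] by simp
  qed
  have "T \<subseteq> R" by (auto simp: T_def Q_def)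
  then have free: "\<not> has_cycle 6 T"
    using assms(5) unfolding has_cycle_def by blast
  have "m * (m - 3) * (m - 6) \<le> 4 * card W"
  proof (rule bipartite_min_degree_C6_free[where S = S])
    show "sym T" using Q(1) by (auto simp: T_def sym_def)
    show "T \<subseteq> W \<times> W" using Q(3) by (auto simp: T_def)
    show "(v \<in> S) \<noteq> (u \<in> S)" if "(u, v) \<in> T" for u v using that by (auto simp: T_def)
  qed (use finW x deg free assms(6) in auto)
  moreover have "card W \<le> card V" by (intro card_mono assms W)
  \<comment> \<open>For \<open>m \<ge> 10\<close> the product of \<open>m - 3\<close> and \<open>m - 6\<close> is at least \<open>m\<^sup>2/4\<close>.\<close>
  moreover have "m ^ 3 \<le> 4 * (m * (m - 3) * (m - 6))"
  proof -
    obtain j where "m = 10 + j" using assms(6) le_Suc_ex by blast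
    then show ?thesis by (simp add: power3_eq_cube algebra_simps)
  qed
  ultimately show ?thesis by linarith
qed

section \<open>Suspensions of cycles and links\<close>

lemma hfree_iff_no_embedding:
  assumes "\<forall>e\<in>edges H. e \<subseteq> verts H"
  shows "hfree H G \<longleftrightarrow>
    \<not> (\<exists>g. inj_on g (verts H) \<and> g ` verts H \<subseteq> verts G \<and> (\<forall>e\<in>edges H. g ` e \<in> edges G))"
    (is "_ \<longleftrightarrow> \<not> (\<exists>g. ?emb g)")
proof -
  have "\<exists>g. ?emb g" if sub: "subhypergraph F G" and "isomorphic F H" for F
  proof -
    obtain f where f: "bij_betw f (verts F) (verts H)" "edges H = (\<lambda>e. f ` e) ` edges F"
      using \<open>isomorphic F H\<close> unfolding isomorphic_def by (elim exE conjE)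
    have F: "verts F \<subseteq> verts G" "edges F \<subseteq> edges G" "\<And>e. e \<in> edges F \<Longrightarrow> e \<subseteq> verts F"
      using sub unfolding subhypergraph_def by simp_all
    define g where "g = inv_into (verts F) f"
    have g: "bij_betw g (verts H) (verts F)"
      unfolding g_def using f(1) by (rule bij_betw_inv_into)
    have "g ` f ` e = e" if "e \<in> edges F" for e
      unfolding g_def using bij_betw_imp_inj_on[OF f(1)] F(3)[OF that]
      by (rule inv_into_image_cancel)
    then have "\<forall>e\<in>edges H. g ` e \<in> edges G"
      unfolding f(2) using F(2) by (simp add: subset_iff)
    moreover have "inj_on g (verts H)" "g ` verts H \<subseteq> verts G"
      using g F(1) by (simp_all add: bij_betw_def)
    ultimately show ?thesis by (intro exI[of _ g] conjI)
  qed
  moreover have "\<exists>F. subhypergraph F G \<and> isomorphic F H" if "?emb g" for g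
  proof -
    from that have g: "inj_on g (verts H)" "g ` verts H \<subseteq> verts G"
      "\<And>e. e \<in> edges H \<Longrightarrow> g ` e \<in> edges G" by simp_all
    define F where "F = (g ` verts H, (\<lambda>e. g ` e) ` edges H)"
    have VF: "verts F = g ` verts H" and EF: "edges F = (\<lambda>e. g ` e) ` edges H"
      by (simp_all add: F_def)
    have "subhypergraph F G"
      unfolding subhypergraph_def VF EF
    proof (intro conjI ballI)
      show "(\<lambda>e. g ` e) ` edges H \<subseteq> edges G" using g(3) by (rule image_subsetI)
      fix e assume "e \<in> (\<lambda>e. g ` e) ` edges H"
      then show "e \<subseteq> g ` verts H" using assms by (elim imageE) (simp add: image_mono)
    qed (rule g(2))
    moreover have "isomorphic F H"
    proof -
      have "inv_into (verts H) g ` g ` e = e" if "e \<in> edges H" for e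
        using g(1) bspec[OF assms that] by (rule inv_into_image_cancel)
      then have "edges H = (\<lambda>e. inv_into (verts H) g ` e) ` edges F"
        by (simp add: EF image_image)
      moreover have "bij_betw (inv_into (verts H) g) (verts F) (verts H)"
        unfolding VF using g(1) by (intro bij_betw_inv_into inj_on_imp_bij_betw)
      ultimately show ?thesis unfolding isomorphic_def by (intro exI conjI)
    qed
    ultimately show ?thesis by (intro exI conjI)
  qed
  ultimately show ?thesis unfolding hfree_def by (metis (no_types, lifting))
qed

text \<open>A triple with a repeated entry spans a set with fewer than three elements, so for a 3-uniform
  hypergraph this relation is symmetric and irreflexive and does not involve \<open>x\<close>.\<close>
definition link :: "'a hypergraph \<Rightarrow> 'a \<Rightarrow> ('a \<times> 'a) set" where
  "link G x = {(u, v). {x, u, v} \<in> edges G}"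

lemma link_distinct:
  assumes "uniform 3 G" "(u, v) \<in> link G x"
  shows "u \<noteq> v" "u \<noteq> x" "v \<noteq> x" "u \<in> verts G" "v \<in> verts G" "x \<in> verts G"
proof -
  have "{x, u, v} \<in> edges G" using assms(2) by (simp add: link_def)
  then have c: "card {x, u, v} = 3" and "{x, u, v} \<subseteq> verts G"
    using assms(1) by (auto simp: uniform_def)
  then show "u \<in> verts G" "v \<in> verts G" "x \<in> verts G" by auto
  show "u \<noteq> v" "u \<noteq> x" "v \<noteq> x" using c by (auto simp: card_insert_if split: if_splits)
qed

lemma sym_link: "sym (link G x)"
  by (auto simp: sym_def link_def insert_commute)

lemma edges_suspension_cycle:
  "edges (suspension (cycle_graph k)) = (\<lambda>i. {None, Some i, Some ((i + 1) mod k)}) ` {..<k}"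
proof -
  have "edges (cycle_graph k) = (\<lambda>i. {i, (i + 1) mod k}) ` {..<k}"
    by (auto simp: cycle_graph_def)
  then show ?thesis by (simp add: suspension_def image_image)
qed

text \<open>An embedding of the suspension is a vertex \<open>x\<close>, the image of the apex, together with a cycle in the
  link of \<open>x\<close>; the cycle avoids \<open>x\<close> since the edges of the hypergraph have three elements.\<close>
lemma hfree_suspension_cycle_iff:
  assumes "uniform 3 G" "0 < k"
  shows "hfree (suspension (cycle_graph k)) G \<longleftrightarrow> (\<forall>x. \<not> has_cycle k (link G x))"
proof -
  define H where "H = suspension (cycle_graph k)"
  have V: "verts H = insert None (Some ` {..<k})"
    by (simp add: H_def suspension_def cycle_graph_def)
  have E: "edges H = (\<lambda>i. {None, Some i, Some ((i + 1) mod k)}) ` {..<k}"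
    unfolding H_def by (rule edges_suspension_cycle)
  have EV: "\<forall>e\<in>edges H. e \<subseteq> verts H"
    using assms(2) by (auto simp: E V)
  have "(\<exists>g. inj_on g (verts H) \<and> g ` verts H \<subseteq> verts G \<and> (\<forall>e\<in>edges H. g ` e \<in> edges G))
    \<longleftrightarrow> (\<exists>x. has_cycle k (link G x))" (is "?L \<longleftrightarrow> ?R")
  proof
    assume ?L
    then obtain g where g: "inj_on g (verts H)" "\<forall>e\<in>edges H. g ` e \<in> edges G" by blast
    have "has_cycle k (link G (g None))"
      unfolding has_cycle_def
    proof (intro exI[of _ "g \<circ> Some"] conjI allI impI)
      show "inj_on (g \<circ> Some) {..<k}"
        using g(1) by (auto simp: V inj_on_def)
      show "((g \<circ> Some) i, (g \<circ> Some) ((i + 1) mod k)) \<in> link G (g None)" if "i < k" for i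
        using g(2) that by (auto simp: E link_def)
    qed
    then show ?R ..
  next
    assume ?R
    then obtain x c where c: "inj_on c {..<k}" "\<forall>i<k. (c i, c ((i + 1) mod k)) \<in> link G x"
      unfolding has_cycle_def by blast
    define g where "g = case_option x c"
    have c_neq: "c i \<noteq> x" "c i \<in> verts G" "x \<in> verts G" if "i < k" for i
      using link_distinct[OF assms(1)] c(2) that by blast+
    have "inj_on g (verts H)"
      using c(1) c_neq by (auto simp: V g_def inj_on_def)
    moreover have "g ` verts H \<subseteq> verts G"
      using c_neq assms(2) by (auto simp: V g_def)
    moreover have "\<forall>e\<in>edges H. g ` e \<in> edges G"
      using c(2) by (auto simp: E g_def link_def)
    ultimately show ?L by blast
  qed
  then show ?thesis
    using hfree_iff_no_embedding[OF EV, of G] by (simp add: H_def)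
qed

section \<open>The upper bound\<close>

lemma card_edges_le_links:
  assumes "finite (verts G)" "uniform 3 G"
    and "\<And>x. x \<in> verts G \<Longrightarrow> card (link G x) \<le> b"
  shows "card (edges G) \<le> card (verts G) * b"
proof -
  define S where "S = (SIGMA x:verts G. link G x)"
  have fin: "finite (link G x)" for x
    by (rule finite_subset[of _ "verts G \<times> verts G"]) (use assms(1) in \<open>auto intro: link_distinct(4,5)[OF assms(2)]\<close>)
  have "edges G \<subseteq> (\<lambda>(x, u, v). {x, u, v}) ` S"
  proof
    fix e assume e: "e \<in> edges G"
    then have "card e = 3" "e \<subseteq> verts G" using assms(2) by (auto simp: uniform_def)
    then obtain x u v where "e = {x, u, v}" by (auto simp: card_3_iff)
    with e \<open>e \<subseteq> verts G\<close> have "(x, u, v) \<in> S" "e = (\<lambda>(x, u, v). {x, u, v}) (x, u, v)"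
      by (auto simp: S_def link_def)
    then show "e \<in> (\<lambda>(x, u, v). {x, u, v}) ` S" by (rule rev_image_eqI)
  qed
  then have "card (edges G) \<le> card S"
    using assms(1) fin by (intro surj_card_le) (auto simp: S_def)
  also have "card S = (\<Sum>x\<in>verts G. card (link G x))"
    unfolding S_def using assms(1) fin by (intro card_SigmaI) auto
  also have "\<dots> \<le> card (verts G) * b"
    using sum_bounded_above[of "verts G" "\<lambda>x. card (link G x)" b] assms(3) by simp
  finally show ?thesis .
qed

lemma cuberoot_cubed:
  fixes x :: real
  assumes "0 < x"
  shows "(x powr (1/3)) ^ 3 = x"
  using assms by (simp add: powr_power)

lemma ex3_suspension_C6_upper:
  assumes "0 < n"
  shows "real (ex3 n (suspension (cycle_graph 6))) \<le> 56 * real n powr (7/3)"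
proof -
  have "edges (suspension (cycle_graph 6)) \<noteq> {}"
    by (simp add: edges_suspension_cycle lessThan_empty_iff)
  from ex3_attained(1)[OF this, of n] obtain G :: "nat hypergraph" where G: "finite (verts G)" "card (verts G) = n" "uniform 3 G"
    "hfree (suspension (cycle_graph 6)) G" "card (edges G) = ex3 n (suspension (cycle_graph 6))"
    by (elim exE conjE)
  define t where "t = real n powr (1/3)"
  have t3: "t ^ 3 = real n" unfolding t_def using assms by (intro cuberoot_cubed) simp
  have t1: "1 \<le> t" unfolding t_def using assms by (intro ge_one_powr_ge_zero) auto
  \<comment> \<open>The factor 3 makes \<open>m\<^sup>3 \<ge> 27 n\<close>, beyond the \<open>16 n\<close> that links without 6-cycles allow;
    the summand 11 covers rounding and the requirement \<open>m \<ge> 10\<close>.\<close>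
  define m where "m = nat \<lfloor>3 * t\<rfloor> + 11"
  have m: "3 * t \<le> real m" "real m \<le> 3 * t + 11" "10 \<le> m"
    unfolding m_def using t1 by linarith+
  have link: "card (link G x) \<le> 4 * m * n" if "x \<in> verts G" for x
  proof (rule ccontr)
    assume "\<not> ?thesis"
    then have big: "4 * m * card (verts G) < card (link G x)" using G(2) by simp
    have "irrefl (link G x)"
      using link_distinct(1)[OF G(3)] unfolding irrefl_def by blast
    moreover have "link G x \<subseteq> verts G \<times> verts G"
      by (auto intro: link_distinct(4,5)[OF G(3)])
    moreover have "\<not> has_cycle 6 (link G x)"
      using G(4) hfree_suspension_cycle_iff[OF G(3), of 6] by simp
    ultimately have "m ^ 3 \<le> 16 * card (verts G)"
      using C6_free_power_bound[OF G(1) sym_link _ _ _ m(3) big] by blast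
    then have "real m ^ 3 \<le> 16 * real n"
      unfolding G(2) by (metis of_nat_le_iff of_nat_mult of_nat_numeral of_nat_power)
    moreover have "(3 * t) ^ 3 \<le> real m ^ 3"
      using m(1) t1 by (intro power_mono) auto
    ultimately show False
      using assms by (simp add: power_mult_distrib t3)
  qed
  have "card (edges G) \<le> card (verts G) * (4 * m * n)"
    using card_edges_le_links[OF G(1,3) link] .
  then have "ex3 n (suspension (cycle_graph 6)) \<le> 4 * m * n ^ 2"
    using G(2,5) by (simp add: power2_eq_square mult_ac)
  then have "real (ex3 n (suspension (cycle_graph 6))) \<le> real (4 * m * n ^ 2)"
    by (rule of_nat_mono)
  also have "\<dots> = 4 * real m * real n ^ 2" by simp
  also have "\<dots> \<le> 4 * (14 * t) * real n ^ 2"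
    using m(2) t1 by (intro mult_right_mono mult_left_mono) auto
  also have "\<dots> = 56 * (t * real n powr 2)"
    using assms by (simp add: powr_numeral)
  also have "t * real n powr 2 = real n powr (1/3 + 2)"
    unfolding t_def by (rule powr_add[symmetric])
  also have "(1/3 + 2 :: real) = 7/3" by simp
  finally show ?thesis .
qed

section \<open>Finite fields of characteristic two\<close>

lemma CHAR_bit: "CHAR(bit) = 2"
proof (rule CHAR_eqI)
  have "of_nat n = (of_bool (odd n) :: bit)" for n
    by (induction n) auto
  then show "2 dvd n" if "of_nat n = (0 :: bit)" for n
    using that by (metis of_bool_eq_0_iff)
qed simp

text \<open>A root that is not a root of the derivative is simple, and over an algebraically closed field the
  number of roots counted with multiplicity is the degree.\<close>
lemma card_roots_alg_closed:
  fixes p :: "'a :: alg_closed_field poly"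
  assumes "\<And>x. poly p x = 0 \<Longrightarrow> poly (pderiv p) x \<noteq> 0"
  shows "card {x. poly p x = 0} = degree p"
proof -
  have nz: "p \<noteq> 0" using assms by force
  obtain A where A: "size A = degree p" "p = smult (lead_coeff p) (\<Prod>x\<in>#A. [:-x, 1:])"
    using alg_closed_imp_factorization[OF nz] by blast
  have "poly p x = lead_coeff p * (\<Prod>y\<in>#A. x - y)" for x
    by (subst A(2)) (simp add: poly_prod_mset image_mset.compositionality o_def)
  then have roots: "{x. poly p x = 0} = set_mset A"
    using nz by (auto simp: prod_mset_zero_iff)
  have count: "count A x \<le> 1" for x
  proof (rule ccontr)
    assume "\<not> count A x \<le> 1"
    then have "replicate_mset 2 x \<subseteq># A"
      by (simp flip: count_le_replicate_mset_subset_eq)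
    then obtain B where B: "A = replicate_mset 2 x + B"
      by (auto simp: subset_mset.le_iff_add)
    define r where "r = smult (lead_coeff p) (\<Prod>y\<in>#B. [:-y, 1:])"
    have p: "p = [:-x, 1:] * ([:-x, 1:] * r)"
      by (subst A(2)) (simp add: B r_def numeral_2_eq_2 mult_ac)
    have "poly p x = 0" "poly (pderiv p) x = 0"
      by (simp_all add: p pderiv_mult pderiv_pCons del: mult_pCons_left)
    with assms show False by blast
  qed
  have "A = mset_set (set_mset A)"
  proof (rule multiset_eqI)
    show "count A x = count (mset_set (set_mset A)) x" for x
      using count[of x] count_greater_zero_iff[of A x] by (cases "x \<in># A") (auto simp: not_in_iff simp del: count_greater_zero_iff)
  qed
  then have "size A = card (set_mset A)"
    by (metis size_mset_set)
  with A(1) roots show ?thesis by simp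
qed

text \<open>The field with \<open>2\<^sup>k\<close> elements, as the set of roots of \<open>X\<^bsup>2^k\<^esup> - X\<close> in the algebraic closure of
  the field with two elements.  The derivative of this polynomial is the constant \<open>-1\<close>, so the roots
  are simple; they are closed under addition by the Frobenius identity.\<close>
lemma subfield_of_order_power_of_two:
  fixes k :: nat
  assumes "k > 0"
  defines "K \<equiv> {x :: bit alg_closure. x ^ (2 ^ k) = x}"
  shows "finite K" "card K = 2 ^ k"
    "\<And>x y. x \<in> K \<Longrightarrow> y \<in> K \<Longrightarrow> x + y \<in> K"
    "\<And>x y. x \<in> K \<Longrightarrow> y \<in> K \<Longrightarrow> x - y \<in> K"
    "\<And>x y. x \<in> K \<Longrightarrow> y \<in> K \<Longrightarrow> x * y \<in> K"
proof -
  have ch: "CHAR(bit alg_closure) = 2" by (simp add: CHAR_bit)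
  have two: "(of_nat (2 ^ k) :: bit alg_closure) = 0"
    using \<open>k > 0\<close> by (simp add: of_nat_eq_0_iff_char_dvd CHAR_bit del: of_nat_power)
  have "(2 :: bit alg_closure) = 0"
    using of_nat_CHAR[where 'a = "bit alg_closure"] by (simp add: CHAR_bit)
  then have "y + y = 0" for y :: "bit alg_closure"
    by (metis mult_2 mult_zero_left)
  then have neg: "- y = y" for y :: "bit alg_closure"
    by (rule minus_unique)
  have minus: "x - y = x + y" for x y :: "bit alg_closure"
    by (subst diff_conv_add_uminus) (simp only: neg)
  define p where "p = (monom 1 (2 ^ k) + monom (- 1) 1 :: bit alg_closure poly)"
  have one: "(1::nat) < 2 ^ k" using \<open>k > 0\<close> by (intro one_less_power) auto
  have deg: "degree p = 2 ^ k"
    unfolding p_def using one by (subst degree_add_eq_left) (auto simp: degree_monom_eq)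
  have K: "K = {x. poly p x = 0}"
    by (simp add: K_def p_def poly_monom)
  have "poly (pderiv p) x = -1" for x
    using two by (simp add: p_def pderiv_add pderiv_monom poly_monom)
  then show cK: "card K = 2 ^ k"
    unfolding K deg[symmetric] by (intro card_roots_alg_closed) simp
  then show "finite K" by (intro card_ge_0_finite) simp
  show add: "x + y \<in> K" if "x \<in> K" "y \<in> K" for x y
    using that freshmans_dream'[of "2 ^ k" k x y] by (simp add: K_def CHAR_bit)
  show "x - y \<in> K" if "x \<in> K" "y \<in> K" for x y
    using add[OF that] by (simp add: minus)
  show "x * y \<in> K" if "x \<in> K" "y \<in> K" for x y
    using that by (simp add: K_def power_mult_distrib)
qed

section \<open>A 3-graph with links of Wenger type\<close>

fun cyclic_rel :: "'a::field \<times> 'a \<times> 'a \<Rightarrow> 'a \<times> 'a \<times> 'a \<Rightarrow> 'a \<times> 'a \<times> 'a \<Rightarrow> bool" where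
  "cyclic_rel (x, x', x'') (y, y', y'') (z, z', z'') \<longleftrightarrow>
     x' + y' + z' = x * y + y * z + z * x \<and>
     x'' + y'' + z'' = x\<^sup>2 * y + y\<^sup>2 * z + z\<^sup>2 * x"

lemma cyclic_rel_rotate: "cyclic_rel u v w \<Longrightarrow> cyclic_rel v w u"
  by (cases u; cases v; cases w) (simp add: ac_simps)

text \<open>Two neighbours of \<open>w\<close> in the link of \<open>u\<close> that share their first coordinate coincide, because the
  defining equations are linear in the other two.  Consequently any two vertices on the same
  side of a 6-cycle in a link, having a common neighbour, differ in their first coordinates.\<close>
lemma cyclic_rel_determined:
  assumes "cyclic_rel u v w" "cyclic_rel u v' w" "fst v = fst v'"
  shows "v = v'"
proof -
  obtain x x' x'' y y' y'' z z' z'' t' t'' where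
    *: "u = (x, x', x'')" "v = (y, y', y'')" "w = (z, z', z'')" "v' = (y, t', t'')"
    using assms(3) by (metis prod.collapse)
  have "x' + y' + z' = x' + t' + z'" "x'' + y'' + z'' = x'' + t'' + z''"
    using assms(1,2) by (simp_all add: *)
  then show ?thesis by (simp add: *)
qed

text \<open>The differences \<open>z\<^sub>0 - z\<^sub>2\<close>, \<open>z\<^sub>1 - z\<^sub>0\<close>, \<open>z\<^sub>2 - z\<^sub>1\<close> sum to 0.  Together with the two hypotheses they
  form a solution of the homogeneous Vandermonde system with nodes \<open>y\<^sub>0, y\<^sub>1, y\<^sub>2\<close>.  The combination
  of the equations in the proof eliminates all of them but \<open>z\<^sub>1 - z\<^sub>0\<close>.\<close>
lemma vandermonde_alternating:
  fixes y\<^sub>0 y\<^sub>1 y\<^sub>2 z\<^sub>0 z\<^sub>1 z\<^sub>2 :: "'a::field"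
  assumes 1: "y\<^sub>0 * (z\<^sub>0 - z\<^sub>2) + y\<^sub>1 * (z\<^sub>1 - z\<^sub>0) + y\<^sub>2 * (z\<^sub>2 - z\<^sub>1) = 0"
    and 2: "y\<^sub>0\<^sup>2 * (z\<^sub>0 - z\<^sub>2) + y\<^sub>1\<^sup>2 * (z\<^sub>1 - z\<^sub>0) + y\<^sub>2\<^sup>2 * (z\<^sub>2 - z\<^sub>1) = 0"
    and "y\<^sub>0 \<noteq> y\<^sub>1" "y\<^sub>1 \<noteq> y\<^sub>2"
  shows "z\<^sub>0 = z\<^sub>1"
proof -
  have "(y\<^sub>1 - y\<^sub>0) * (y\<^sub>1 - y\<^sub>2) * (z\<^sub>1 - z\<^sub>0) =
    (y\<^sub>0\<^sup>2 * (z\<^sub>0 - z\<^sub>2) + y\<^sub>1\<^sup>2 * (z\<^sub>1 - z\<^sub>0) + y\<^sub>2\<^sup>2 * (z\<^sub>2 - z\<^sub>1)) -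
    (y\<^sub>0 + y\<^sub>2) * (y\<^sub>0 * (z\<^sub>0 - z\<^sub>2) + y\<^sub>1 * (z\<^sub>1 - z\<^sub>0) + y\<^sub>2 * (z\<^sub>2 - z\<^sub>1))"
    by (simp add: algebra_simps power2_eq_square)
  also have "\<dots> = 0" unfolding 1 2 by simp
  finally show ?thesis using assms(3,4) by simp
qed

text \<open>In the alternating sum of the six equations around the hexagon, the left-hand sides cancel, and so do
  all terms on the right that involve only one of \<open>y\<close> and \<open>z\<close>.  What remains are the
  hypotheses of \<open>vandermonde_alternating\<close>.\<close>
lemma cyclic_rel_no_hexagon:
  assumes rel: "cyclic_rel u a\<^sub>0 b\<^sub>0" "cyclic_rel u a\<^sub>1 b\<^sub>0" "cyclic_rel u a\<^sub>1 b\<^sub>1"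
      "cyclic_rel u a\<^sub>2 b\<^sub>1" "cyclic_rel u a\<^sub>2 b\<^sub>2" "cyclic_rel u a\<^sub>0 b\<^sub>2"
    and "a\<^sub>0 \<noteq> a\<^sub>1" "a\<^sub>1 \<noteq> a\<^sub>2" "b\<^sub>0 \<noteq> b\<^sub>1"
  shows False
proof -
  obtain x x' x'' where u: "u = (x, x', x'')" by (cases u)
  obtain y\<^sub>0 y\<^sub>0' y\<^sub>0'' where a0: "a\<^sub>0 = (y\<^sub>0, y\<^sub>0', y\<^sub>0'')" by (cases a\<^sub>0)
  obtain y\<^sub>1 y\<^sub>1' y\<^sub>1'' where a1: "a\<^sub>1 = (y\<^sub>1, y\<^sub>1', y\<^sub>1'')" by (cases a\<^sub>1)
  obtain y\<^sub>2 y\<^sub>2' y\<^sub>2'' where a2: "a\<^sub>2 = (y\<^sub>2, y\<^sub>2', y\<^sub>2'')" by (cases a\<^sub>2)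
  obtain z\<^sub>0 z\<^sub>0' z\<^sub>0'' where b0: "b\<^sub>0 = (z\<^sub>0, z\<^sub>0', z\<^sub>0'')" by (cases b\<^sub>0)
  obtain z\<^sub>1 z\<^sub>1' z\<^sub>1'' where b1: "b\<^sub>1 = (z\<^sub>1, z\<^sub>1', z\<^sub>1'')" by (cases b\<^sub>1)
  obtain z\<^sub>2 z\<^sub>2' z\<^sub>2'' where b2: "b\<^sub>2 = (z\<^sub>2, z\<^sub>2', z\<^sub>2'')" by (cases b\<^sub>2)
  have "fst a\<^sub>0 \<noteq> fst a\<^sub>1" "fst a\<^sub>1 \<noteq> fst a\<^sub>2"
    using cyclic_rel_determined rel assms(7,8) by blast+
  then have y: "y\<^sub>0 \<noteq> y\<^sub>1" "y\<^sub>1 \<noteq> y\<^sub>2" by (simp_all add: a0 a1 a2)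
  have "fst b\<^sub>0 \<noteq> fst b\<^sub>1"
    using cyclic_rel_determined[of a\<^sub>1 _ u, OF _ _ ] cyclic_rel_rotate rel(2,3) assms(9) by blast
  then have z: "z\<^sub>0 \<noteq> z\<^sub>1" by (simp add: b0 b1)
  note E = rel[unfolded u a0 a1 a2 b0 b1 b2 cyclic_rel.simps]
  have "y\<^sub>0 * (z\<^sub>0 - z\<^sub>2) + y\<^sub>1 * (z\<^sub>1 - z\<^sub>0) + y\<^sub>2 * (z\<^sub>2 - z\<^sub>1) =
      (x * y\<^sub>0 + y\<^sub>0 * z\<^sub>0 + z\<^sub>0 * x) - (x * y\<^sub>1 + y\<^sub>1 * z\<^sub>0 + z\<^sub>0 * x) +
      (x * y\<^sub>1 + y\<^sub>1 * z\<^sub>1 + z\<^sub>1 * x) - (x * y\<^sub>2 + y\<^sub>2 * z\<^sub>1 + z\<^sub>1 * x) +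
      (x * y\<^sub>2 + y\<^sub>2 * z\<^sub>2 + z\<^sub>2 * x) - (x * y\<^sub>0 + y\<^sub>0 * z\<^sub>2 + z\<^sub>2 * x)"
    by (simp add: algebra_simps)
  also have "\<dots> = (x' + y\<^sub>0' + z\<^sub>0') - (x' + y\<^sub>1' + z\<^sub>0') + (x' + y\<^sub>1' + z\<^sub>1') - (x' + y\<^sub>2' + z\<^sub>1') +
      (x' + y\<^sub>2' + z\<^sub>2') - (x' + y\<^sub>0' + z\<^sub>2')"
    by (simp only: E)
  also have "\<dots> = 0" by simp
  finally have 1: "y\<^sub>0 * (z\<^sub>0 - z\<^sub>2) + y\<^sub>1 * (z\<^sub>1 - z\<^sub>0) + y\<^sub>2 * (z\<^sub>2 - z\<^sub>1) = 0" .
  have "y\<^sub>0\<^sup>2 * (z\<^sub>0 - z\<^sub>2) + y\<^sub>1\<^sup>2 * (z\<^sub>1 - z\<^sub>0) + y\<^sub>2\<^sup>2 * (z\<^sub>2 - z\<^sub>1) =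
      (x\<^sup>2 * y\<^sub>0 + y\<^sub>0\<^sup>2 * z\<^sub>0 + z\<^sub>0\<^sup>2 * x) - (x\<^sup>2 * y\<^sub>1 + y\<^sub>1\<^sup>2 * z\<^sub>0 + z\<^sub>0\<^sup>2 * x) +
      (x\<^sup>2 * y\<^sub>1 + y\<^sub>1\<^sup>2 * z\<^sub>1 + z\<^sub>1\<^sup>2 * x) - (x\<^sup>2 * y\<^sub>2 + y\<^sub>2\<^sup>2 * z\<^sub>1 + z\<^sub>1\<^sup>2 * x) +
      (x\<^sup>2 * y\<^sub>2 + y\<^sub>2\<^sup>2 * z\<^sub>2 + z\<^sub>2\<^sup>2 * x) - (x\<^sup>2 * y\<^sub>0 + y\<^sub>0\<^sup>2 * z\<^sub>2 + z\<^sub>2\<^sup>2 * x)"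
    by (simp add: algebra_simps)
  also have "\<dots> = (x'' + y\<^sub>0'' + z\<^sub>0'') - (x'' + y\<^sub>1'' + z\<^sub>0'') + (x'' + y\<^sub>1'' + z\<^sub>1'') -
      (x'' + y\<^sub>2'' + z\<^sub>1'') + (x'' + y\<^sub>2'' + z\<^sub>2'') - (x'' + y\<^sub>0'' + z\<^sub>2'')"
    by (simp only: E)
  also have "\<dots> = 0" by simp
  finally show False
    using vandermonde_alternating[OF 1 _ y] z by blast
qed

text \<open>The first component of a vertex names its part.\<close>
definition cyclic_hypergraph :: "'a::field set \<Rightarrow> (nat \<times> 'a \<times> 'a \<times> 'a) hypergraph" where
  "cyclic_hypergraph K = ({..<3} \<times> K \<times> K \<times> K,
     {{(0, u), (1, v), (2, w)} | u v w.
        u \<in> K \<times> K \<times> K \<and> v \<in> K \<times> K \<times> K \<and> w \<in> K \<times> K \<times> K \<and> cyclic_rel u v w})"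

lemma uniform_cyclic_hypergraph: "uniform 3 (cyclic_hypergraph K)"
  by (auto simp: uniform_def cyclic_hypergraph_def)

lemma insert3_eq_cases:
  assumes "{p, q, r} = {a, b, c}" "a \<noteq> b" "b \<noteq> c" "a \<noteq> c"
  shows "p = a \<and> (q = b \<and> r = c \<or> q = c \<and> r = b) \<or>
    p = b \<and> (q = c \<and> r = a \<or> q = a \<and> r = c) \<or>
    p = c \<and> (q = a \<and> r = b \<or> q = b \<and> r = a)"
proof -
  have "p \<in> {a, b, c}" "a \<in> {p, q, r}" "b \<in> {p, q, r}" "c \<in> {p, q, r}"
    using assms(1) by blast+
  with assms(2-4) show ?thesis by auto
qed

text \<open>By rotation invariance the three parts can be treated alike: the link of a vertex in part \<open>i\<close> is
  bipartite between the parts \<open>i + 1\<close> and \<open>i + 2\<close> modulo 3.\<close>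
lemma link_cyclic_hypergraph:
  assumes "(q, r) \<in> link (cyclic_hypergraph K) p"
  shows "fst q = (fst p + 1) mod 3 \<and> fst r = (fst p + 2) mod 3 \<and> cyclic_rel (snd p) (snd q) (snd r)
    \<or> fst r = (fst p + 1) mod 3 \<and> fst q = (fst p + 2) mod 3 \<and> cyclic_rel (snd p) (snd r) (snd q)"
proof -
  obtain u v w where e: "{p, q, r} = {(0, u), (1, v), (2, w)}" and rel: "cyclic_rel u v w"
    using assms by (auto simp: link_def cyclic_hypergraph_def)
  have rel': "cyclic_rel v w u" "cyclic_rel w u v"
    using cyclic_rel_rotate rel by blast+
  from insert3_eq_cases[OF e] have
    "p = (0, u) \<and> (q = (1, v) \<and> r = (2, w) \<or> q = (2, w) \<and> r = (1, v)) \<or>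
     p = (1, v) \<and> (q = (2, w) \<and> r = (0, u) \<or> q = (0, u) \<and> r = (2, w)) \<or>
     p = (2, w) \<and> (q = (0, u) \<and> r = (1, v) \<or> q = (1, v) \<and> r = (0, u))" by simp
  then show ?thesis
    using rel rel' by (elim disjE conjE) simp_all
qed

lemma cyclic_hypergraph_links_C6_free: "\<not> has_cycle 6 (link (cyclic_hypergraph K) p)"
proof
  assume "has_cycle 6 (link (cyclic_hypergraph K) p)"
  then obtain a b c d e f where dist: "distinct [a, b, c, d, e, f]" and
    "(a, b) \<in> link (cyclic_hypergraph K) p" "(b, c) \<in> link (cyclic_hypergraph K) p"
    "(c, d) \<in> link (cyclic_hypergraph K) p" "(d, e) \<in> link (cyclic_hypergraph K) p"
    "(e, f) \<in> link (cyclic_hypergraph K) p" "(f, a) \<in> link (cyclic_hypergraph K) p"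
    unfolding has_cycle_6_iff by blast
  note links = this(2-7)[THEN link_cyclic_hypergraph]
  define s where "s = (fst p + 1) mod 3"
  define t where "t = (fst p + 2) mod 3"
  have "s \<noteq> t" unfolding s_def t_def by presburger
  note links = links[folded s_def t_def]
  have hexagon: False if "distinct [a, b, c, d, e, f]"
    "fst a = s" "fst b = t" "fst c = s" "fst d = t"  "fst e = s" "fst f = t"
    "cyclic_rel (snd p) (snd a) (snd b)" "cyclic_rel (snd p) (snd c) (snd b)"
    "cyclic_rel (snd p) (snd c) (snd d)" "cyclic_rel (snd p) (snd e) (snd d)"
    "cyclic_rel (snd p) (snd e) (snd f)" "cyclic_rel (snd p) (snd a) (snd f)" for a b c d e f
    using cyclic_rel_no_hexagon[OF that(8-13)] that(1-7) by (auto simp: prod_eq_iff)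
  show False
  proof (cases "fst a = s")
    case True
    with links \<open>s \<noteq> t\<close> show False
      by (intro hexagon[of a b c d e f] dist) auto
  next
    case False
    with links \<open>s \<noteq> t\<close> dist show False
      by (intro hexagon[of b c d e f a]) auto
  qed
qed

text \<open>An edge can be chosen freely up to the last two coordinates of its third vertex, which the two
  equations then determine.\<close>
lemma card_edges_cyclic_hypergraph:
  fixes K :: "'a::field set"
  assumes fin: "finite K"
    and add: "\<And>x y. x \<in> K \<Longrightarrow> y \<in> K \<Longrightarrow> x + y \<in> K"
    and diff: "\<And>x y. x \<in> K \<Longrightarrow> y \<in> K \<Longrightarrow> x - y \<in> K"
    and mult: "\<And>x y. x \<in> K \<Longrightarrow> y \<in> K \<Longrightarrow> x * y \<in> K"
  shows "card K ^ 7 \<le> card (edges (cyclic_hypergraph K))"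
proof -
  define f where "f = (\<lambda>(x :: 'a, x', x'', y, y', y'', z).
    {(0::nat, (x, x', x'')), (1, (y, y', y'')),
     (2, (z, x * y + y * z + z * x - x' - y', x\<^sup>2 * y + y\<^sup>2 * z + z\<^sup>2 * x - x'' - y''))})"
  have "card (K \<times> K \<times> K \<times> K \<times> K \<times> K \<times> K) \<le> card (edges (cyclic_hypergraph K))"
  proof (rule card_inj_on_le)
    show "inj_on f (K \<times> K \<times> K \<times> K \<times> K \<times> K \<times> K)"
    proof (rule inj_onI)
      fix p q assume "f p = f q"
      obtain x x' x'' y y' y'' z where p: "p = (x, x', x'', y, y', y'', z)"
        by (cases p rule: prod_cases7)
      obtain t t' t'' u u' u'' v where q: "q = (t, t', t'', u, u', u'', v)"
        by (cases q rule: prod_cases7)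
      have eq: "f (x, x', x'', y, y', y'', z) = f (t, t', t'', u, u', u'', v)"
        using \<open>f p = f q\<close> unfolding p q .
      have "(0, (x, x', x'')) \<in> f (t, t', t'', u, u', u'', v)"
        "(1, (y, y', y'')) \<in> f (t, t', t'', u, u', u'', v)"
        "\<exists>w. (2, (z, w)) \<in> f (t, t', t'', u, u', u'', v)"
        unfolding eq[symmetric] by (auto simp: f_def)
      then show "p = q"
        by (auto simp: f_def p q)
    qed
    show "f ` (K \<times> K \<times> K \<times> K \<times> K \<times> K \<times> K) \<subseteq> edges (cyclic_hypergraph K)"
    proof (rule image_subsetI, clarify)
      fix x x' x'' y y' y'' z
      assume in_K: "x \<in> K" "x' \<in> K" "x'' \<in> K" "y \<in> K" "y' \<in> K" "y'' \<in> K" "z \<in> K"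
      then have "x * y + y * z + z * x - x' - y' \<in> K"
        "x\<^sup>2 * y + y\<^sup>2 * z + z\<^sup>2 * x - x'' - y'' \<in> K"
        unfolding power2_eq_square by (simp_all add: add diff mult)
      moreover have rel: "cyclic_rel (x, x', x'') (y, y', y'')
          (z, x * y + y * z + z * x - x' - y', x\<^sup>2 * y + y\<^sup>2 * z + z\<^sup>2 * x - x'' - y'')"
        by (simp add: algebra_simps)
      ultimately show "f (x, x', x'', y, y', y'', z) \<in> edges (cyclic_hypergraph K)"
        unfolding f_def cyclic_hypergraph_def prod.case snd_conv
        using in_K by (intro CollectI exI conjI refl) (simp_all only: mem_Times_iff fst_conv snd_conv simp_thms)
    qed
    have "edges (cyclic_hypergraph K) \<subseteq> Pow (verts (cyclic_hypergraph K))"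
      using uniform_cyclic_hypergraph[of K] by (auto simp: uniform_def)
    then show "finite (edges (cyclic_hypergraph K))"
      by (rule finite_subset) (simp add: cyclic_hypergraph_def fin)
  qed
  then show ?thesis by (simp add: card_cartesian_product eval_nat_numeral mult.assoc)
qed

section \<open>The lower bound\<close>

text \<open>A copy of \<open>G\<close> inside \<open>{..<n}\<close>, padded with isolated vertices, is a host on exactly \<open>n\<close> vertices:
  a cycle in one of its links avoids the isolated vertices, so it can be pulled back to \<open>G\<close>.\<close>
lemma ex3_suspension_cycle_lower:
  fixes G :: "'a hypergraph"
  assumes "finite (verts G)" "card (verts G) \<le> n" "uniform 3 G" "0 < k"
    and "\<And>x. \<not> has_cycle k (link G x)"
  shows "card (edges G) \<le> ex3 n (suspension (cycle_graph k))"
proof -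
  obtain g :: "'a \<Rightarrow> nat" where g: "inj_on g (verts G)" "g ` verts G \<subseteq> {..<n}"
    using card_le_inj[of "verts G" "{..<n}"] assms(1,2) by auto
  define h where "h = inv_into (verts G) g"
  define N where "N = ({..<n}, (\<lambda>e. g ` e) ` edges G)"
  have EG: "e \<subseteq> verts G" "card e = 3" if "e \<in> edges G" for e
    using assms(3) that by (auto simp: uniform_def)
  have hg: "h ` g ` e = e" if "e \<in> edges G" for e
    unfolding h_def using g(1) EG(1)[OF that] by (rule inv_into_image_cancel)
  have uN: "uniform 3 N"
    unfolding uniform_def
  proof
    fix e' assume "e' \<in> edges N"
    then obtain e where e: "e \<in> edges G" "e' = g ` e" by (auto simp: N_def)
    have "card e' = card e"
      unfolding e(2) by (intro card_image inj_on_subset[OF g(1)] EG(1) e(1))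
    moreover have "e' \<subseteq> {..<n}"
      unfolding e(2) using g(2) EG(1)[OF e(1)] by blast
    ultimately show "e' \<subseteq> verts N \<and> card e' = 3"
      using EG(2)[OF e(1)] by (simp add: N_def)
  qed
  have "\<not> has_cycle k (link N x)" for x
  proof
    assume "has_cycle k (link N x)"
    then obtain c where c: "inj_on c {..<k}" "\<forall>i<k. (c i, c ((i + 1) mod k)) \<in> link N x"
      unfolding has_cycle_def by blast
    have e: "{h x, h (c i), h (c ((i + 1) mod k))} \<in> edges G" "c i \<in> g ` verts G" if "i < k" for i
    proof -
      have "{x, c i, c ((i + 1) mod k)} \<in> (\<lambda>e. g ` e) ` edges G"
        using c(2) that by (simp add: link_def N_def)
      then obtain e where e: "e \<in> edges G" "{x, c i, c ((i + 1) mod k)} = g ` e"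
        by (elim imageE)
      have "h ` {x, c i, c ((i + 1) mod k)} = e"
        using hg[OF e(1)] unfolding e(2) .
      with e(1) show "{h x, h (c i), h (c ((i + 1) mod k))} \<in> edges G" by simp
      have "c i \<in> g ` e" unfolding e(2)[symmetric] by simp
      then show "c i \<in> g ` verts G" using EG(1)[OF e(1)] by blast
    qed
    have "inj_on h (c ` {..<k})"
      unfolding h_def using e(2) by (intro inj_on_inv_into) auto
    with c(1) have "inj_on (h \<circ> c) {..<k}" by (rule comp_inj_on)
    moreover have "\<forall>i<k. ((h \<circ> c) i, (h \<circ> c) ((i + 1) mod k)) \<in> link G (h x)"
      using e(1) by (simp add: link_def)
    ultimately have "has_cycle k (link G (h x))"
      unfolding has_cycle_def by blast
    with assms(5) show False by blast
  qed
  then have "hfree (suspension (cycle_graph k)) N"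
    using hfree_suspension_cycle_iff[OF uN \<open>0 < k\<close>] by blast
  moreover have "edges (suspension (cycle_graph k)) \<noteq> {}"
    using \<open>0 < k\<close> by (auto simp: edges_suspension_cycle)
  ultimately have "card (edges N) \<le> ex3 n (suspension (cycle_graph k))"
    using uN by (intro ex3_attained(2)) (auto simp: N_def)
  moreover have "inj_on (\<lambda>e. g ` e) (edges G)"
    using hg by (rule inj_on_inverseI)
  then have "card (edges N) = card (edges G)"
    by (simp add: N_def card_image)
  ultimately show ?thesis by simp
qed

lemma ex3_suspension_C6_lower:
  assumes "24 \<le> n"
  shows "real n powr (7/3) \<le> 2187 * real (ex3 n (suspension (cycle_graph 6)))"
proof -
  \<comment> \<open>The construction over the field with \<open>2\<^sup>k\<close> elements has \<open>3 \<cdot> 8\<^sup>k\<close> vertices; \<open>k\<close> is the largest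
    exponent for which it fits into \<open>n\<close> vertices.\<close>
  define m where "m = (LEAST m. n < 3 * 8 ^ m)"
  have "n < 2 ^ n" by (rule less_exp)
  also have "\<dots> \<le> 8 ^ n" by (rule power_mono) auto
  also have "\<dots> \<le> 3 * 8 ^ n" by simp
  finally have above: "n < 3 * 8 ^ m"
    unfolding m_def by (rule LeastI)
  have below: "3 * 8 ^ j \<le> n" if "j < m" for j
    using not_less_Least[OF that[unfolded m_def]] by simp
  have "m \<noteq> 0" using above assms by (cases "m = 0") auto
  moreover have "m \<noteq> 1" using above assms by (cases "m = 1") auto
  ultimately obtain k where m: "m = Suc k" and "1 \<le> k" by (cases m) auto
  have k: "3 * 8 ^ k \<le> n" using below m by simp
  have "(8::nat) ^ k = (2 ^ 3) ^ k" by simp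
  also have "\<dots> = (2 ^ k) ^ 3" by (simp only: mult.commute flip: power_mult)
  finally have eight: "(8::nat) ^ k = (2 ^ k) ^ 3" .
  \<comment> \<open>By maximality of \<open>k\<close>, \<open>n < 24 \<cdot> 8\<^sup>k\<close>; rounding 24 up to the cube 27 avoids roots.\<close>
  have n_less: "n \<le> (3 * 2 ^ k) ^ 3"
    using above by (simp add: m power_mult_distrib eight)
  define K where "K = {x :: bit alg_closure. x ^ (2 ^ k) = x}"
  note K = subfield_of_order_power_of_two[of k, folded K_def]
  have "(2 ^ k) ^ 7 \<le> card (edges (cyclic_hypergraph K))"
    using card_edges_cyclic_hypergraph[of K] K \<open>1 \<le> k\<close> by simp
  also have "\<dots> \<le> ex3 n (suspension (cycle_graph 6))"
  proof (rule ex3_suspension_cycle_lower)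
    show "finite (verts (cyclic_hypergraph K))"
      using K(1) \<open>1 \<le> k\<close> by (simp add: cyclic_hypergraph_def)
    have "card (verts (cyclic_hypergraph K)) = 3 * (2 ^ k) ^ 3"
      using K(2) \<open>1 \<le> k\<close> by (simp add: cyclic_hypergraph_def card_cartesian_product power3_eq_cube)
    also have "\<dots> \<le> n" using k by (simp only: eight)
    finally show "card (verts (cyclic_hypergraph K)) \<le> n" .
  qed (simp_all only: uniform_cyclic_hypergraph cyclic_hypergraph_links_C6_free, simp_all)
  finally have "real ((2 ^ k) ^ 7) \<le> real (ex3 n (suspension (cycle_graph 6)))"
    by (rule of_nat_mono)
  then have main: "(2 ^ k) ^ 7 \<le> real (ex3 n (suspension (cycle_graph 6)))" by simp
  have "real n powr (7/3) = (real n powr (1/3)) ^ 7"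
    using assms by (simp add: powr_power)
  also have "\<dots> \<le> (3 * 2 ^ k) ^ 7"
  proof (rule power_mono)
    have "real n \<le> (3 * 2 ^ k) ^ 3"
      using of_nat_mono[OF n_less, where 'a = real] by simp
    then have "(real n powr (1/3)) ^ 3 \<le> (3 * 2 ^ k) ^ 3"
      using cuberoot_cubed[of "real n"] assms by simp
    then show "real n powr (1/3) \<le> 3 * 2 ^ k"
      by (subst (asm) power_mono_iff) simp_all
  qed simp
  also have "\<dots> = 2187 * (2 ^ k) ^ 7" by (simp add: power_mult_distrib)
  also have "\<dots> \<le> 2187 * real (ex3 n (suspension (cycle_graph 6)))"
    using main by simp
  finally show ?thesis .
qed

theorem corollary1p3:
  shows "(\<lambda>n::nat. real (ex3 n (suspension (cycle_graph 6)))) \<in> \<Theta>(\<lambda>n. real n powr (7 / 3))"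
proof (rule bigthetaI)
  show "(\<lambda>n. real (ex3 n (suspension (cycle_graph 6)))) \<in> O(\<lambda>n. real n powr (7/3))"
  proof (rule bigoI)
    show "\<forall>\<^sub>F n in sequentially. norm (real (ex3 n (suspension (cycle_graph 6))))
        \<le> 56 * norm (real n powr (7/3))"
      using eventually_gt_at_top[of 0]
      by eventually_elim (simp add: ex3_suspension_C6_upper)
  qed
  have "(\<lambda>n. real n powr (7/3)) \<in> O(\<lambda>n. real (ex3 n (suspension (cycle_graph 6))))"
  proof (rule bigoI)
    show "\<forall>\<^sub>F n in sequentially. norm (real n powr (7/3))
        \<le> 2187 * norm (real (ex3 n (suspension (cycle_graph 6))))"
      using eventually_ge_at_top[of 24]
      by eventually_elim (simp add: ex3_suspension_C6_lower)
  qed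
  then show "(\<lambda>n. real (ex3 n (suspension (cycle_graph 6)))) \<in> \<Omega>(\<lambda>n. real n powr (7/3))"
    by (simp add: bigomega_iff_bigo)
qed

end
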